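(* Let $\delta\in[0,1)$, $\Delta\subseteq\{0,1\}^N$ and $g:\Delta\to\{0,1\}$ a partial Boolean function. For any $R$-round randomized AMPC algorithm with I/O capacity $S\ge2$ that computes $g$ with error at most $\delta$, we have $C_\delta(g)\le 2S^{6R}$. In particular $R\ge\frac16\log_S\frac{C_\delta(g)}{2}$.
   Context: AMPC model with I/O capacity $S$: computation proceeds in rounds communicating through distributed data stores (DDS) $\mathcal{D}_0,\dots,\mathcal{D}_R$, each storing under each key a multiset of values (possibly empty; duplicates allowed, each value written by a unique machine). On input $x\in\{0,1\}^N$, $\mathcal{D}_0$ consists of the pairs $(i,x_i)$. In round $r\ge1$ each machine (arbitrarily many, computationally unbounded, deterministic) adaptively queries keys of $\mathcal{D}_{r-1}$, receiving the whole multiset under the key, with later queries depending arbitrarily on earlier ones and their responses; the total number of values in responses plus the number of empty-response queries is at most $S$; it then writes at most $S$ key-value pairs to $\mathcal{D}_r$ as a function of its queries and responses. Algorithms are also run on invalid inputs $x\notin\Delta$ (a machine exceeding its budget stops and writes nothing), and in every round, on every input in $\{0,1\}^N$, at most $S$ values are written under any single key. A deterministic algorithm outputs $b$ on $x$ if $\mathcal{D}_R$ contains exactly the single pair $(\textsc{answer},b)$. A randomized AMPC algorithm is a probability distribution over deterministic AMPC algorithms; its number of rounds is the maximum over its support; it computes $g$ with error at most $\delta$ if for each $x\in\Delta$ it outputs $g(x)$ with probability at least $1-\delta$. Canonical distribution $\mathcal{D}_g$ on $\Delta$: with probability $1/2$ a uniformly random element of $g^{-1}(1)$, with probability $1/2$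 a uniformly random element of $g^{-1}(0)$. A certificate of $f:\Delta\to\{0,1\}$ on $x\in\Delta$ is a set $C\subseteq\{1,\dots,N\}$ such that every $y\in\Delta$ with $y|_C=x|_C$ has $f(y)=f(x)$; $C(f)=\max_{x\in\Delta}\min\{|C|: C\text{ certificate on }x\}$. The $\delta$-approximate certificate complexity is $C_\delta(g)=\min\{C(f): f:\Delta\to\{0,1\},\ \Pr_{x\sim\mathcal{D}_g}[f(x)\ne g(x)]\le\delta\}$. *)

theory Defs
  imports "HOL-Probability.Probability" "HOL-Library.Multiset"
begin

(* Keys of the distributed data stores: input keys (index i, 0-based), the
   special key ANSWER, and arbitrary auxiliary keys.  Values are natural numbers. *)
datatype akey = InKey nat | AnsKey | AuxKey nat

type_synonym dds = "akey \<Rightarrow> nat multiset"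

type_synonym history = "(akey \<times> nat multiset) list"

(* After seeing a history, a deterministic machine either issues a further query
   or halts and writes a list of key-value pairs. *)
datatype action = Query akey | Halt "(akey \<times> nat) list"

type_synonym program = "history \<Rightarrow> action"

(* A deterministic AMPC algorithm: for each round, the (finite) list of machines. *)
type_synonym det_alg = "program list list"

(* Execution of one machine on store D with remaining budget b (fuel n).
   A query costs the number of returned values, or 1 if the response is empty.
   A machine exceeding its budget stops and writes nothing. *)
fun exec :: "nat \<Rightarrow> nat \<Rightarrow> program \<Rightarrow> dds \<Rightarrow> history \<Rightarrow> (akey \<times> nat) list" where
  "exec 0 b P D h = []"
| "exec (Suc n) b P D h =
     (case P h of
        Halt w \<Rightarrow> w
      | Query k \<Rightarrow>
          (let c = (if D k = {#} then 1 else size (D k))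
           in if b < c then [] else exec n (b - c) P D (h @ [(k, D k)])))"

(* Each query costs at least 1, so fuel S+1 suffices for budget S. *)
definition machine_writes :: "nat \<Rightarrow> program \<Rightarrow> dds \<Rightarrow> (akey \<times> nat) list" where
  "machine_writes S P D = exec (Suc S) S P D []"

definition round_step :: "nat \<Rightarrow> program list \<Rightarrow> dds \<Rightarrow> dds" where
  "round_step S Ms D =
     (\<lambda>k. \<Sum>P\<leftarrow>Ms. mset (map snd (filter (\<lambda>p. fst p = k) (machine_writes S P D))))"

definition init_dds :: "bool list \<Rightarrow> dds" where
  "init_dds x = (\<lambda>k. case k of
       InKey i \<Rightarrow> (if i < length x then {# of_bool (x ! i) #} else {#})
     | _ \<Rightarrow> {#})"

definition run_dds :: "nat \<Rightarrow> det_alg \<Rightarrow> bool list \<Rightarrow> nat \<Rightarrow> dds" where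
  "run_dds S A x r = fold (round_step S) (take r A) (init_dds x)"

definition outputs :: "nat \<Rightarrow> det_alg \<Rightarrow> bool list \<Rightarrow> bool \<Rightarrow> bool" where
  "outputs S A x b \<longleftrightarrow>
     run_dds S A x (length A) = (\<lambda>k. {#})(AnsKey := {# of_bool b #})"

definition valid_ampc :: "nat \<Rightarrow> nat \<Rightarrow> det_alg \<Rightarrow> bool" where
  "valid_ampc S N A \<longleftrightarrow>
     (\<forall>Ms\<in>set A. \<forall>P\<in>set Ms. \<forall>h w. P h = Halt w \<longrightarrow> length w \<le> S) \<and>
     (\<forall>x. length x = N \<longrightarrow> (\<forall>r \<le> length A. \<forall>k. size (run_dds S A x r k) \<le> S))"

definition is_certificate ::
  "nat \<Rightarrow> bool list set \<Rightarrow> (bool list \<Rightarrow> bool) \<Rightarrow> bool list \<Rightarrow> nat set \<Rightarrow> bool" where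
  "is_certificate N \<Delta> f x C \<longleftrightarrow>
     C \<subseteq> {..<N} \<and> (\<forall>y\<in>\<Delta>. (\<forall>i\<in>C. y ! i = x ! i) \<longrightarrow> f y = f x)"

definition cert_complexity :: "nat \<Rightarrow> bool list set \<Rightarrow> (bool list \<Rightarrow> bool) \<Rightarrow> nat" where
  "cert_complexity N \<Delta> f =
     Sup ((\<lambda>x. Inf (card ` {C. is_certificate N \<Delta> f x C})) ` \<Delta>)"

(* Pr_{x ~ D_g}[f x \<noteq> g x] for the canonical distribution D_g *)
definition canon_err :: "bool list set \<Rightarrow> (bool list \<Rightarrow> bool) \<Rightarrow> (bool list \<Rightarrow> bool) \<Rightarrow> real" where
  "canon_err \<Delta> g f =
     1/2 * real (card {x\<in>\<Delta>. g x \<and> f x \<noteq> g x}) / real (card {x\<in>\<Delta>. g x})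
   + 1/2 * real (card {x\<in>\<Delta>. \<not> g x \<and> f x \<noteq> g x}) / real (card {x\<in>\<Delta>. \<not> g x})"

definition approx_cert :: "nat \<Rightarrow> bool list set \<Rightarrow> (bool list \<Rightarrow> bool) \<Rightarrow> real \<Rightarrow> nat" where
  "approx_cert N \<Delta> g \<delta> = Inf {cert_complexity N \<Delta> f | f. canon_err \<Delta> g f \<le> \<delta>}"

end

theory Submission
  imports Defs
begin

text \<open>Some algorithm A in the support of the distribution has canonical error at most \<open>\<delta>\<close>, by
  averaging. Let f be the total function telling whether A stores exactly 1 under the answer key.
  The indicator of each store content is a real multilinear polynomial in the input bits whose
  degree grows by a factor of at most S^2 per round, so f has degree at most d = S^(2R).

  A minimal sensitive block of f has at most d elements, since f restricted to the block is a
  conjunction or its negation. Symmetrizing over a family of n disjoint sensitive blocks gives a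
  univariate polynomial of degree at most d with values 1 at 0, 0 at 1, and in [0,1] at the
  integers up to n; interpolation at 1 and the points 2j^2 shows n < 2d^2. A maximal family of
  disjoint minimal sensitive blocks is a certificate, and it has at most 2d^3 elements.\<close>

section \<open>Multilinear degree of set functions\<close>

text \<open>\<open>of_bool (A \<subseteq> X)\<close> is the product of the variables in
  \<open>A\<close> at the indicator vector of \<open>X\<close>, so this is real multilinear degree
  on 0/1 points. Generating the polynomials one monomial at a time turns every closure property into
  an induction and asks for no finite set of variables.\<close>

inductive deg_le :: "nat \<Rightarrow> ('a set \<Rightarrow> real) \<Rightarrow> bool" for d where
  zero: "deg_le d (\<lambda>X. 0)"
| add_monomial: "deg_le d F \<Longrightarrow> finite A \<Longrightarrow> card A \<le> d \<Longrightarrow>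
    deg_le d (\<lambda>X. F X + c * of_bool (A \<subseteq> X))"

lemma deg_le_const: "deg_le d (\<lambda>X. c)"
  using deg_le.add_monomial[OF deg_le.zero, of "{}" d c] by simp

lemma deg_le_mem: "1 \<le> d \<Longrightarrow> deg_le d (\<lambda>X. of_bool (a \<in> X))"
  using deg_le.add_monomial[OF deg_le.zero, of "{a}" d 1] by simp

lemma deg_le_mono: "deg_le d F \<Longrightarrow> d \<le> e \<Longrightarrow> deg_le e F"
  by (induction rule: deg_le.induct) (auto intro: deg_le.intros)

lemma deg_le_add:
  assumes "deg_le d F" "deg_le d G" shows "deg_le d (\<lambda>X. F X + G X)"
  using assms(2)
proof (induction rule: deg_le.induct)
  case zero
  show ?case using assms(1) by simp
next
  case (add_monomial G A c)
  from deg_le.add_monomial[OF add_monomial.IH add_monomial.hyps(2,3), of c]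
  show ?case by (simp add: add.assoc)
qed

lemma deg_le_cmult: "deg_le d F \<Longrightarrow> deg_le d (\<lambda>X. c * F X)"
proof (induction rule: deg_le.induct)
  case zero
  show ?case using deg_le.zero by simp
next
  case (add_monomial F A c')
  from deg_le.add_monomial[OF add_monomial.IH add_monomial.hyps(2,3), of "c * c'"]
  show ?case by (simp add: algebra_simps)
qed

lemma deg_le_diff:
  assumes "deg_le d F" "deg_le d G" shows "deg_le d (\<lambda>X. F X - G X)"
  using deg_le_add[OF assms(1) deg_le_cmult[OF assms(2), of "-1"]] by simp

text \<open>On 0/1 points a variable equals its square, so the monomials of \<open>B\<close> and
  \<open>A\<close> multiply to that of \<open>B \<union> A\<close>.\<close>

lemma deg_le_mult_monomial:
  assumes "deg_le d F" "finite A" "card A \<le> e"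
  shows "deg_le (d + e) (\<lambda>X. F X * of_bool (A \<subseteq> X))"
  using assms(1)
proof (induction rule: deg_le.induct)
  case zero
  show ?case using deg_le.zero by simp
next
  case (add_monomial F B c)
  have "card (B \<union> A) \<le> d + e"
    using card_Un_le[of B A] add_monomial.hyps assms(3) by linarith
  then have "deg_le (d + e) (\<lambda>X. F X * of_bool (A \<subseteq> X) + c * of_bool (B \<union> A \<subseteq> X))"
    using add_monomial assms(2) by (intro deg_le.add_monomial) auto
  moreover have "F X * of_bool (A \<subseteq> X) + c * of_bool (B \<union> A \<subseteq> X)
      = (F X + c * of_bool (B \<subseteq> X)) * of_bool (A \<subseteq> X)" for X
    by (auto simp: of_bool_def)
  ultimately show ?case by simp
qed

lemma deg_le_mult:
  assumes "deg_le d F" "deg_le e G" shows "deg_le (d + e) (\<lambda>X. F X * G X)"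
  using assms(2)
proof (induction rule: deg_le.induct)
  case zero
  show ?case using deg_le.zero by simp
next
  case (add_monomial G A c)
  have "deg_le (d + e) (\<lambda>X. F X * G X + c * (F X * of_bool (A \<subseteq> X)))"
    by (intro deg_le_add add_monomial.IH deg_le_cmult deg_le_mult_monomial assms(1)
        add_monomial.hyps)
  then show ?case by (simp add: algebra_simps)
qed

lemma deg_le_sum: "(\<And>i. i \<in> I \<Longrightarrow> deg_le d (F i)) \<Longrightarrow> deg_le d (\<lambda>X. \<Sum>i\<in>I. F i X)"
proof (induction I rule: infinite_finite_induct)
  case (insert i I)
  then show ?case by (simp add: deg_le_add)
qed (simp_all add: deg_le.zero)

lemma deg_le_sum_list:
  "(\<And>i. i \<in> set L \<Longrightarrow> deg_le d (F i)) \<Longrightarrow> deg_le d (\<lambda>X. \<Sum>i\<leftarrow>L. F i X)"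
  by (induction L) (simp_all add: deg_le_add deg_le.zero)

lemma deg_le_prod:
  "finite I \<Longrightarrow> (\<And>i. i \<in> I \<Longrightarrow> deg_le (e i) (F i)) \<Longrightarrow>
    deg_le (\<Sum>i\<in>I. e i) (\<lambda>X. \<Prod>i\<in>I. F i X)"
proof (induction I rule: finite_induct)
  case empty
  show ?case using deg_le_const by simp
next
  case (insert i I)
  then show ?case by (simp add: deg_le_mult)
qed

lemma deg_le_poly:
  assumes "deg_le e u" shows "deg_le (e * degree p) (\<lambda>X. poly p (u X))"
proof (induction p)
  case 0
  show ?case using deg_le.zero by simp
next
  case (pCons a p)
  show ?case
  proof (cases "p = 0")
    case True
    then show ?thesis using deg_le_const by simp
  next
    case False
    have "deg_le (e + e * degree p) (\<lambda>X. a + u X * poly p (u X))"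
      by (intro deg_le_add deg_le_const deg_le_mult assms pCons.IH)
    then show ?thesis using False by simp
  qed
qed

section \<open>Substituting flips of disjoint blocks\<close>

definition flip :: "'a set \<Rightarrow> 'a set \<Rightarrow> 'a set" where
  "flip X B = (X - B) \<union> (B - X)"

lemma flip_empty [simp]: "flip X {} = X"
  by (simp add: flip_def)

text \<open>By disjointness a point \<open>a\<close> lies in at most one block \<open>B i\<close>,
  so its membership in the flipped set is a constant, the variable \<open>i\<close> or one minus it.
  Replacing each variable of a monomial by such an affine form keeps the degree. Empty blocks are
  allowed, so a finite family can be extended to the whole index type.\<close>

lemma deg_le_flip_blocks:
  assumes "deg_le d F" and disj: "\<And>i j. i \<noteq> j \<Longrightarrow> B i \<inter> B j = {}"
  shows "deg_le d (\<lambda>T. F (flip X (\<Union>i\<in>T. B i)))"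
  using assms(1)
proof (induction rule: deg_le.induct)
  case zero
  show ?case by (rule deg_le.zero)
next
  case (add_monomial F A c)
  have mem: "deg_le 1 (\<lambda>T. of_bool (a \<in> flip X (\<Union>i\<in>T. B i)))" for a
  proof (cases "\<exists>i. a \<in> B i")
    case True
    then obtain i where i: "a \<in> B i" by blast
    have "j = i" if "a \<in> B j" for j using disj[of j i] i that by (cases "j = i") auto
    then have "a \<in> (\<Union>i\<in>T. B i) \<longleftrightarrow> i \<in> T" for T using i by (metis UN_iff)
    then have "of_bool (a \<in> flip X (\<Union>i\<in>T. B i))
        = (if a \<in> X then 1 - of_bool (i \<in> T) else of_bool (i \<in> T) :: real)" for T
      by (auto simp: flip_def)
    moreover have "deg_le 1 (\<lambda>T. if a \<in> X then 1 - of_bool (i \<in> T) else of_bool (i \<in> T))"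
      using deg_le_diff[OF deg_le_const[of 1 1] deg_le_mem[of 1 i]] deg_le_mem[of 1 i]
      by (cases "a \<in> X") simp_all
    ultimately show ?thesis by simp
  next
    case False
    then have "of_bool (a \<in> flip X (\<Union>i\<in>T. B i)) = (of_bool (a \<in> X) :: real)" for T
      by (auto simp: flip_def)
    then show ?thesis by (simp only: deg_le_const)
  qed
  have "deg_le (\<Sum>a\<in>A. 1) (\<lambda>T. \<Prod>a\<in>A. of_bool (a \<in> flip X (\<Union>i\<in>T. B i)))"
    by (intro deg_le_prod mem add_monomial.hyps)
  moreover have "(\<Prod>a\<in>A. of_bool (a \<in> Y)) = (of_bool (A \<subseteq> Y) :: real)" for Y
    using add_monomial.hyps(2) by (induction A rule: finite_induct) auto
  ultimately have "deg_le d (\<lambda>T. of_bool (A \<subseteq> flip X (\<Union>i\<in>T. B i)))"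
    using add_monomial.hyps(3) deg_le_mono by fastforce
  then show ?case
    by (intro deg_le_add add_monomial.IH deg_le_cmult)
qed

text \<open>For \<open>u\<close> in \<open>U\<close> but outside \<open>A\<close>, the terms of
  \<open>T\<close> and \<open>insert u T\<close> cancel: the signs differ and the monomial does not
  see \<open>u\<close>.\<close>

lemma alternating_sum_monomial:
  assumes "finite U" "\<not> U \<subseteq> A"
  shows "(\<Sum>T\<in>Pow U. (-1) ^ card T * of_bool (A \<subseteq> T)) = (0::real)"
proof -
  obtain u where u: "u \<in> U" "u \<notin> A" using assms(2) by blast
  define V where "V = U - {u}"
  have V: "finite V" "u \<notin> V" "U = insert u V" using assms(1) u by (auto simp: V_def)
  have "(\<Sum>T\<in>Pow U. (-1) ^ card T * of_bool (A \<subseteq> T))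
      = (\<Sum>T\<in>Pow V. (-1) ^ card T * of_bool (A \<subseteq> T))
        + (\<Sum>T\<in>insert u ` Pow V. (-1) ^ card T * of_bool (A \<subseteq> T) :: real)"
    unfolding V(3) Pow_insert using V by (intro sum.union_disjoint) auto
  also have "(\<Sum>T\<in>insert u ` Pow V. (-1) ^ card T * of_bool (A \<subseteq> T) :: real)
      = (\<Sum>T\<in>Pow V. (-1) ^ card (insert u T) * of_bool (A \<subseteq> insert u T))"
    using V by (subst sum.reindex) (auto simp: inj_on_def)
  also have "\<dots> = (\<Sum>T\<in>Pow V. - ((-1) ^ card T * of_bool (A \<subseteq> T)))"
  proof (intro sum.cong refl)
    fix T assume "T \<in> Pow V"
    then have "finite T" "u \<notin> T" using V finite_subset by auto
    then show "(-1) ^ card (insert u T) * of_bool (A \<subseteq> insert u T)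
        = - ((-1) ^ card T * of_bool (A \<subseteq> T) :: real)"
      using u(2) by (auto simp: subset_insert)
  qed
  finally show ?thesis by (simp add: sum_negf)
qed

text \<open>The sum is, up to sign, a difference of order \<open>card U\<close>, which kills lower
  degrees: a monomial with at most \<open>d\<close> variables cannot contain
  \<open>U\<close>.\<close>

lemma alternating_sum_deg_le:
  assumes "deg_le d F" "finite U" "d < card U"
  shows "(\<Sum>T\<in>Pow U. (-1) ^ card T * F T) = 0"
  using assms(1)
proof (induction rule: deg_le.induct)
  case zero
  show ?case by simp
next
  case (add_monomial F A c)
  have "\<not> U \<subseteq> A"
    using card_mono[of A U] add_monomial.hyps assms(3) by fastforce
  from alternating_sum_monomial[OF assms(2) this] add_monomial.IH show ?case
    by (simp add: distrib_left sum.distrib mult.left_commute flip: sum_distrib_left)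
qed

section \<open>A univariate polynomial bound\<close>

lemma sum_card_eq_Pow:
  assumes "finite U"
  shows "(\<Sum>T\<in>Pow U. f (card T)) = (\<Sum>k\<le>card U. real (card U choose k) * f k)"
proof -
  have "(\<Sum>T\<in>Pow U. f (card T))
      = (\<Sum>k\<le>card U. \<Sum>T\<in>{T \<in> Pow U. card T = k}. f (card T))"
    using assms by (intro sum.group[symmetric]) (auto intro: card_mono)
  also have "\<dots> = (\<Sum>k\<le>card U. real (card U choose k) * f k)"
  proof (intro sum.cong refl)
    fix k
    have "card {T \<in> Pow U. card T = k} = card U choose k"
      using n_subsets[OF assms, of k] by simp
    then show "(\<Sum>T\<in>{T \<in> Pow U. card T = k}. f (card T)) = real (card U choose k) * f k"
      by simp
  qed
  finally show ?thesis .
qed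

text \<open>This is the difference of order 2d of a polynomial in k of degree below 2d. To reduce it
  to \<open>alternating_sum_deg_le\<close>, k becomes the size of a subset of a set with 2d
  elements; on those subsets \<open>c T\<close> is \<open>card T - d\<close>, and it has degree
  1.\<close>

lemma alternating_binomial_sum_centered:
  fixes t :: "real poly"
  assumes "degree t < d"
  shows "(\<Sum>k\<le>2*d. real ((2*d) choose k) * ((-1) ^ k * poly t (2 * (real k - real d)^2))) = 0"
proof -
  define U where "U = {..<2*d}"
  define c where "c T = (\<Sum>u\<in>U. of_bool (u \<in> T)) - real d" for T
  have U: "finite U" "card U = 2*d" by (auto simp: U_def)
  have "deg_le 1 c"
    unfolding c_def by (intro deg_le_diff deg_le_sum deg_le_mem deg_le_const) auto
  from deg_le_cmult[OF deg_le_mult[OF this this], of 2]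
  have "deg_le 2 (\<lambda>T. 2 * (c T)^2)" by (simp add: power2_eq_square numeral_2_eq_2)
  from deg_le_poly[OF this, of t]
  have "(\<Sum>T\<in>Pow U. (-1) ^ card T * poly t (2 * (c T)^2)) = 0"
    by (rule alternating_sum_deg_le) (use assms U in auto)
  moreover have "c T = real (card T) - real d" if "T \<in> Pow U" for T
  proof -
    have "U \<inter> {u. u \<in> T} = T" using that by auto
    then show ?thesis using U by (simp add: c_def)
  qed
  ultimately have "(\<Sum>T\<in>Pow U. (-1) ^ card T * poly t (2 * (real (card T) - real d)^2)) = 0"
    by simp
  then show ?thesis
    using sum_card_eq_Pow[OF U(1), of "\<lambda>k. (-1) ^ k * poly t (2 * (real k - real d)^2)"] U(2)
    by simp
qed

lemma sum_symmetric_interval: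
  fixes a :: "nat \<Rightarrow> real"
  shows "m \<le> d \<Longrightarrow> (\<Sum>k=d-m..d+m. a k) = a d + (\<Sum>j=1..m. a (d - j) + a (d + j))"
proof (induction m)
  case (Suc m)
  have "{d - Suc m..d + Suc m} = insert (d - Suc m) (insert (d + Suc m) {d - m..d + m})"
    using Suc.prems by auto
  moreover have "d - Suc m \<notin> insert (d + Suc m) {d - m..d + m}" "d + Suc m \<notin> {d - m..d + m}"
    using Suc.prems by auto
  ultimately show ?case using Suc by simp
qed simp

lemma even_reciprocal_sum_less_1:
  "(\<Sum>j=1..d. if even j then 2 / (2 * (real j)^2 - 1) else 0) < (1::real)"
proof -
  \<comment> \<open>The remainder is 1/(m+1) for the largest even m up to d. A new even j = d+1 adds
    at most 2/(j^2-1) = 1/d - 1/(d+2), so the bound telescopes.\<close>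
  have "(\<Sum>j=1..d. if even j then 2 / (2 * (real j)^2 - 1) else 0)
      \<le> 1 - (if even d then 1 / (real d + 1) else 1 / real d)"
  proof (induction d)
    case (Suc d)
    show ?case
    proof (cases "even d")
      case True
      then show ?thesis using Suc by (simp add: add.commute)
    next
      case False
      then have d: "real d \<ge> 1" by (cases d) auto
      have "2 / (2 * (real (Suc d))^2 - 1) \<le> 2 / (real d * (real d + 2))"
        using d by (intro divide_left_mono mult_pos_pos)
          (auto simp: power2_eq_square algebra_simps add_pos_nonneg)
      also have "\<dots> = 1 / real d - 1 / (real d + 2)"
        using d by (simp add: field_simps)
      finally show ?thesis using Suc False by (simp add: add.commute)
    qed
  qed simp
  also have "\<dots> < 1" by (cases d) auto
  finally show ?thesis .
qed

text \<open>Dividing out the node 1 and taking the central difference of order 2d in y, where the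
  argument is 2y^2, expresses the value at 0 through the values at 2j^2; only the even j contribute
  positively, and their weights sum to less than 1.\<close>

lemma no_small_degree_poly:
  fixes q :: "real poly"
  assumes deg: "degree q \<le> d" and q0: "poly q 0 = 1" and q1: "poly q 1 = 0"
    and bnd: "\<And>j. 1 \<le> j \<Longrightarrow> j \<le> d \<Longrightarrow>
      0 \<le> poly q (2 * (real j)^2) \<and> poly q (2 * (real j)^2) \<le> 1"
  shows False
proof -
  obtain t where t: "q = [:-1, 1:] * t" using q1 by (auto simp: poly_eq_0_iff_dvd dvd_def)
  have "q \<noteq> 0" using q0 by auto
  then have "t \<noteq> 0" using t by auto
  then have "degree q = Suc (degree t)" unfolding t by (subst degree_mult_eq) auto
  then have dt: "degree t < d" using deg by simp
  have pq: "poly q y = (y - 1) * poly t y" for y by (simp add: t algebra_simps)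
  define M where "M = real ((2*d) choose d)"
  have "M > 0" by (simp add: M_def)
  define a where "a k = real ((2*d) choose k) * ((-1) ^ k * poly t (2 * (real k - real d)^2))" for k
  have "(\<Sum>k\<le>2*d. a k) = 0"
    unfolding a_def by (rule alternating_binomial_sum_centered[OF dt])
  moreover have "{..2*d} = {d-d..d+d}" by auto
  ultimately have z: "a d + (\<Sum>j=1..d. a (d - j) + a (d + j)) = 0"
    using sum_symmetric_interval[of d d a] by simp
  \<comment> \<open>From q(y) = (y-1) t(y) and q(0) = 1 follows t(0) = -1. The factor (-1)^d removes
    the sign of the central term, which the remaining terms must then balance.\<close>
  have ad: "(-1)^d * a d = - M"
    using pq[of 0] q0 by (simp add: a_def M_def flip: power_add mult_2)
  have summand: "(-1)^d * (a (d - j) + a (d + j))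
      \<le> M * (if even j then 2 / (2 * (real j)^2 - 1) else 0)" if j: "1 \<le> j" "j \<le> d" for j
  proof -
    define s where "s = poly t (2 * (real j)^2)"
    define b where "b = real ((2*d) choose (d + j))"
    have pos: "2 * (real j)^2 - 1 > 0"
      using j(1) one_le_power[of "real j" 2] by linarith
    have "s = poly q (2 * (real j)^2) / (2 * (real j)^2 - 1)"
      using pos by (simp add: pq s_def)
    then have s: "0 \<le> s" "s \<le> 1 / (2 * (real j)^2 - 1)"
      using bnd[OF j] pos by (auto simp: divide_right_mono)
    have b: "0 \<le> b" "b \<le> M"
      using binomial_maximum'[of d "d + j"] by (auto simp: b_def M_def)
    have sym: "(2*d) choose (d - j) = (2*d) choose (d + j)"
      using binomial_symmetric[of "d - j" "2*d"] j by (simp add: mult_2)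
    have sg: "(-1::real)^d * (-1)^(d+j) = (-1)^j" "(-1::real)^d * (-1)^(d-j) = (-1)^j"
      using j by (auto simp: minus_one_power_iff)
    have "(-1)^d * a (d + j) = ((-1::real)^d * (-1)^(d+j)) * (b * s)"
      by (simp add: a_def b_def s_def)
    moreover have "(-1)^d * a (d - j) = ((-1::real)^d * (-1)^(d-j)) * (b * s)"
      using j by (simp add: a_def b_def s_def sym of_nat_diff)
    ultimately have eq: "(-1)^d * (a (d - j) + a (d + j)) = (-1)^j * (2 * (b * s))"
      unfolding sg by (simp add: distrib_left)
    \<comment> \<open>For odd j the pair is thus nonpositive; for even j the binomial coefficient is
      replaced by the central one, which is the largest.\<close>
    have "0 \<le> b * s" using b s by simp
    moreover have "b * s \<le> M * (1 / (2 * (real j)^2 - 1))"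
      using b s by (intro mult_mono) auto
    then have "2 * (b * s) \<le> M * 2 / (2 * (real j)^2 - 1)" using pos by (simp add: field_simps)
    ultimately show ?thesis unfolding eq by (cases "even j") auto
  qed
  have "0 = (-1)^d * (a d + (\<Sum>j=1..d. a (d - j) + a (d + j)))" using z by simp
  also have "\<dots> = - M + (\<Sum>j=1..d. (-1)^d * (a (d - j) + a (d + j)))"
    by (simp only: distrib_left[of "(-1)^d" "a d"] ad sum_distrib_left)
  also have "\<dots> \<le> - M + (\<Sum>j=1..d. M * (if even j then 2 / (2 * (real j)^2 - 1) else 0))"
    by (intro add_left_mono sum_mono summand) auto
  also have "\<dots> = - M + M * (\<Sum>j=1..d. if even j then 2 / (2 * (real j)^2 - 1) else 0)"
    by (simp only: sum_distrib_left)
  also have "\<dots> < - M + M * 1"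
    by (intro add_strict_left_mono mult_strict_left_mono even_reciprocal_sum_less_1 \<open>M > 0\<close>)
  finally show False by simp
qed

section \<open>Block sensitivity and certificates\<close>

lemma card_supersets_of_size:
  assumes "finite U" "A \<subseteq> U" "card A \<le> k"
  shows "card {T. T \<subseteq> U \<and> card T = k \<and> A \<subseteq> T} = (card U - card A) choose (k - card A)"
proof -
  have fA: "finite A" using assms finite_subset by blast
  have "{T. T \<subseteq> U \<and> card T = k \<and> A \<subseteq> T}
      = (\<lambda>T. T \<union> A) ` {T. T \<subseteq> U - A \<and> card T = k - card A}" (is "?L = ?R")
  proof
    show "?L \<subseteq> ?R"
    proof
      fix T assume "T \<in> ?L"
      then have "T = (T - A) \<union> A" "T - A \<subseteq> U - A" "card (T - A) = k - card A"
        using fA by (auto simp: card_Diff_subset)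
      then show "T \<in> ?R" by blast
    qed
    show "?R \<subseteq> ?L"
    proof
      fix T assume "T \<in> ?R"
      then obtain T' where T': "T = T' \<union> A" "T' \<subseteq> U - A" "card T' = k - card A" by blast
      have "card T = card T' + card A"
        unfolding T'(1) using T' fA assms(1)
        by (intro card_Un_disjoint) (auto intro: finite_subset)
      then show "T \<in> ?L" using T' assms by auto
    qed
  qed
  moreover have "inj_on (\<lambda>T. T \<union> A) {T. T \<subseteq> U - A \<and> card T = k - card A}"
    by (rule inj_onI) auto
  ultimately have "card ?L = card {T. T \<subseteq> U - A \<and> card T = k - card A}"
    by (simp add: card_image)
  also have "\<dots> = card (U - A) choose (k - card A)"
    using assms(1) by (intro n_subsets) auto
  also have "card (U - A) = card U - card A"
    using assms fA by (intro card_Diff_subset)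
  finally show ?thesis .
qed

lemma ex_binomial_poly:
  "\<exists>p :: real poly. degree p \<le> a \<and> (\<forall>k. poly p (real k) = real (k choose a))"
proof -
  define p :: "real poly" where "p = smult (1 / fact a) (\<Prod>i<a. [:- real i, 1:])"
  have "degree (\<Prod>i<a. [:- real i, 1:]) \<le> (\<Sum>i<a. degree [:- real i, 1:])"
    using degree_prod_sum_le[of "{..<a}" "\<lambda>i. [:- real i, 1:]"] by (simp add: o_def)
  then have "degree p \<le> a"
    unfolding p_def using degree_smult_le order_trans by fastforce
  moreover have "poly p (real k) = real (k choose a)" for k
    by (simp add: p_def poly_prod binomial_gbinomial gbinomial_prod_rev atLeast0LessThan)
  ultimately show ?thesis by blast
qed

text \<open>The fraction of k-subsets of an n-set that contain a fixed a-subset is (k choose a)/(n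
  choose a), a polynomial in k of degree a. By linearity the average of \<open>h\<close> over the
  k-subsets is a polynomial of degree at most \<open>d\<close>.\<close>

lemma symmetrization:
  assumes "deg_le d h" "finite U"
  shows "\<exists>p. degree p \<le> d \<and> (\<forall>k\<le>card U.
    (\<Sum>T\<in>{T. T \<subseteq> U \<and> card T = k}. h T) = real (card U choose k) * poly p (real k))"
  using assms(1)
proof (induction rule: deg_le.induct)
  case zero
  show ?case by (intro exI[of _ 0]) auto
next
  case (add_monomial F A c)
  then obtain p where p: "degree p \<le> d" "\<And>k. k \<le> card U \<Longrightarrow>
    (\<Sum>T\<in>{T. T \<subseteq> U \<and> card T = k}. F T) = real (card U choose k) * poly p (real k)" by blast
  define n where "n = card U"
  define a where "a = card A"
  obtain b :: "real poly" where b: "degree b \<le> a" "\<And>k. poly b (real k) = real (k choose a)"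
    using ex_binomial_poly by blast
  \<comment> \<open>A monomial that reaches outside \<open>U\<close> vanishes on every subset of
    \<open>U\<close>.\<close>
  define s where "s = (if A \<subseteq> U then c / real (n choose a) else 0)"
  have mono: "(\<Sum>T\<in>{T. T \<subseteq> U \<and> card T = k}. c * of_bool (A \<subseteq> T))
      = real (n choose k) * (s * real (k choose a))" if k: "k \<le> n" for k
  proof (cases "A \<subseteq> U \<and> a \<le> k")
    case True
    then have an: "a \<le> n" using assms(2) by (auto simp: a_def n_def intro: card_mono)
    have fin: "finite {T. T \<subseteq> U \<and> card T = k}" using assms(2) by auto
    have "(\<Sum>T\<in>{T. T \<subseteq> U \<and> card T = k}. c * of_bool (A \<subseteq> T))
        = c * real (card ({T. T \<subseteq> U \<and> card T = k} \<inter> {T. A \<subseteq> T}))"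
      using fin by (simp flip: sum_distrib_left)
    also have "{T. T \<subseteq> U \<and> card T = k} \<inter> {T. A \<subseteq> T} = {T. T \<subseteq> U \<and> card T = k \<and> A \<subseteq> T}"
      by auto
    also have "card \<dots> = (n - a) choose (k - a)"
      using card_supersets_of_size[OF assms(2), of A k] True by (simp add: n_def a_def)
    finally have L: "(\<Sum>T\<in>{T. T \<subseteq> U \<and> card T = k}. c * of_bool (A \<subseteq> T))
        = c * real ((n - a) choose (k - a))" .
    have "(n choose k) * (k choose a) = (n choose a) * ((n - a) choose (k - a))"
      using True k by (intro choose_mult) auto
    then have "real (n choose k) * real (k choose a)
        = real (n choose a) * real ((n - a) choose (k - a))"
      by (metis of_nat_mult)
    moreover have "real (n choose a) > 0" using an by simp
    ultimately show ?thesis unfolding L using True by (simp add: s_def field_simps)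
  next
    case False
    have "\<not> A \<subseteq> T" if "T \<subseteq> U" "card T = k" for T
    proof
      assume "A \<subseteq> T"
      moreover have "finite T" using that assms(2) finite_subset by blast
      ultimately show False using False that card_mono[of T A] by (auto simp: a_def)
    qed
    then have "(\<Sum>T\<in>{T. T \<subseteq> U \<and> card T = k}. c * of_bool (A \<subseteq> T)) = 0"
      by (intro sum.neutral) auto
    moreover have "s * real (k choose a) = 0" using False by (auto simp: s_def)
    ultimately show ?thesis by simp
  qed
  have "degree (p + smult s b) \<le> d"
    using p(1) b(1) add_monomial.hyps(3) unfolding a_def
    by (intro degree_add_le) (auto intro: order_trans[OF degree_smult_le])
  moreover have "(\<Sum>T\<in>{T. T \<subseteq> U \<and> card T = k}. F T + c * of_bool (A \<subseteq> T))
      = real (card U choose k) * poly (p + smult s b) (real k)" if "k \<le> card U" for k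
    using p(2)[OF that] mono[of k] that by (simp add: sum.distrib b(2) n_def distrib_left)
  ultimately show ?case by blast
qed

text \<open>The bound is the largest node 2d^2 of \<open>no_small_degree_poly\<close>: if
  \<open>card U\<close> reached it, the symmetrized polynomial would be an average of values in
  [0,1] at every node 2j^2 with j up to d.\<close>

lemma fully_sensitive_card_less:
  assumes deg: "deg_le d h" and "d \<ge> 1" and U: "finite U"
    and bnd: "\<And>T. T \<subseteq> U \<Longrightarrow> 0 \<le> h T \<and> h T \<le> 1"
    and h0: "h {} = 1" and h1: "\<And>u. u \<in> U \<Longrightarrow> h {u} = 0"
  shows "card U < 2 * d^2"
proof (rule ccontr)
  assume "\<not> card U < 2 * d^2"
  then have n: "2 * d^2 \<le> card U" by simp
  then have n1: "1 \<le> card U" using \<open>d \<ge> 1\<close> one_le_power[of d 2] by linarith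
  obtain p where p: "degree p \<le> d" and pk: "\<And>k. k \<le> card U \<Longrightarrow>
    (\<Sum>T\<in>{T. T \<subseteq> U \<and> card T = k}. h T) = real (card U choose k) * poly p (real k)"
    using symmetrization[OF deg U] by blast
  have "{T. T \<subseteq> U \<and> card T = 0} = {{}}" using U by (auto dest: finite_subset)
  then have p0: "poly p 0 = 1" using pk[of 0] h0 by simp
  have "h T = 0" if "T \<subseteq> U" "card T = 1" for T
    using that h1 by (auto simp: card_1_singleton_iff)
  then have "(\<Sum>T\<in>{T. T \<subseteq> U \<and> card T = 1}. h T) = 0" by (intro sum.neutral) auto
  then have p1: "poly p 1 = 0" using pk[of 1] n1 by auto
  have pb: "0 \<le> poly p (real k) \<and> poly p (real k) \<le> 1" if k: "k \<le> card U" for k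
  proof -
    have c: "real (card U choose k) > 0" using k by simp
    have "0 \<le> (\<Sum>T\<in>{T. T \<subseteq> U \<and> card T = k}. h T)"
      using bnd by (intro sum_nonneg) auto
    moreover have "(\<Sum>T\<in>{T. T \<subseteq> U \<and> card T = k}. h T)
        \<le> (\<Sum>T\<in>{T. T \<subseteq> U \<and> card T = k}. 1)"
      using bnd by (intro sum_mono) auto
    ultimately show ?thesis
      using c pk[OF k] n_subsets[OF U, of k] by (simp add: zero_le_mult_iff)
  qed
  show False
  proof (rule no_small_degree_poly[OF p p0 p1])
    fix j assume "1 \<le> j" "j \<le> d"
    then have "2 * j^2 \<le> card U"
      using n power_mono[of j d 2] by linarith
    from pb[OF this] show "0 \<le> poly p (2 * (real j)^2) \<and> poly p (2 * (real j)^2) \<le> 1" by simp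
  qed
qed

section \<open>Minimal sensitive blocks and the certificates they form\<close>

definition minimal_block :: "('a set \<Rightarrow> bool) \<Rightarrow> 'a set \<Rightarrow> 'a set \<Rightarrow> bool" where
  "minimal_block f X B \<longleftrightarrow>
     finite B \<and> f (flip X B) \<noteq> f X \<and> (\<forall>B'. B' \<subset> B \<longrightarrow> f (flip X B') = f X)"

lemma minimal_block_nonempty: "minimal_block f X B \<Longrightarrow> B \<noteq> {}"
  by (auto simp: minimal_block_def)

lemma ex_minimal_block:
  assumes "finite D" "f (flip X D) \<noteq> f X"
  shows "\<exists>B\<subseteq>D. minimal_block f X B"
  using assms
proof (induction D rule: finite_psubset_induct)
  case (psubset D)
  show ?case
  proof (cases "minimal_block f X D")
    case False
    then obtain B where "B \<subset> D" "f (flip X B) \<noteq> f X"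
      using psubset.hyps psubset.prems by (auto simp: minimal_block_def)
    then show ?thesis using psubset.IH[of B] by blast
  qed blast
qed

lemma deg_le_agree:
  assumes "deg_le d (\<lambda>X. of_bool (f X))"
  shows "deg_le d (\<lambda>X. of_bool (f X = b))"
proof -
  have "of_bool (f X = b) = (if b then of_bool (f X) else 1 - of_bool (f X) :: real)" for X
    by auto
  then show ?thesis
    using assms deg_le_diff[OF deg_le_const[of d 1] assms] by (cases b) simp_all
qed

text \<open>As a function of the flipped part \<open>T\<close> of \<open>B\<close>, disagreement
  with \<open>f X\<close> is 1 at \<open>T = B\<close> and 0 at all proper subsets. Its alternating
  sum has one nonzero term, whereas degree below \<open>card B\<close> would make it 0.\<close>

lemma minimal_block_card_le:
  assumes deg: "deg_le d (\<lambda>X. of_bool (f X))" and B: "minimal_block f X B"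
  shows "card B \<le> d"
proof (rule ccontr)
  assume "\<not> card B \<le> d"
  then have lt: "d < card B" by simp
  have fin: "finite B" and ne: "f (flip X B) \<noteq> f X"
    and sub: "\<And>B'. B' \<subset> B \<Longrightarrow> f (flip X B') = f X"
    using B by (auto simp: minimal_block_def)
  \<comment> \<open>The blocks are singletons here, so their union over \<open>T\<close> is
    \<open>T\<close> itself.\<close>
  have "deg_le d (\<lambda>T. of_bool (f (flip X (\<Union>i\<in>T. {i})) = f X))"
    by (rule deg_le_flip_blocks[OF deg_le_agree[OF deg]]) auto
  then have h: "deg_le d (\<lambda>T. 1 - of_bool (f (flip X T) = f X))"
    by (intro deg_le_diff deg_le_const) simp
  have "(\<Sum>T\<in>Pow B. (-1) ^ card T * (1 - of_bool (f (flip X T) = f X))) = (0::real)"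
    by (rule alternating_sum_deg_le[OF h fin lt])
  moreover have "(\<Sum>T\<in>Pow B. (-1) ^ card T * (1 - of_bool (f (flip X T) = f X)) :: real)
      = (\<Sum>T\<in>{B}. (-1) ^ card T * (1 - of_bool (f (flip X T) = f X)))"
    using fin sub by (intro sum.mono_neutral_right) auto
  ultimately show False using ne by simp
qed

lemma disjoint_blocks_card_less:
  assumes deg: "deg_le d (\<lambda>X. of_bool (f X))" and "d \<ge> 1"
    and fin: "finite \<B>" and disj: "disjoint \<B>"
    and sens: "\<And>B. B \<in> \<B> \<Longrightarrow> f (flip X B) \<noteq> f X"
  shows "card \<B> < 2 * d^2"
proof -
  \<comment> \<open>Each block serves as its own index and is one variable of \<open>h\<close>; sets
    outside \<open>\<B>\<close> index the empty block, which keeps the whole family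
    disjoint.\<close>
  define h :: "'a set set \<Rightarrow> real"
    where "h T = of_bool (f (flip X (\<Union>B\<in>T. if B \<in> \<B> then B else {})) = f X)" for T
  have h: "deg_le d h"
    unfolding h_def using disj
    by (intro deg_le_flip_blocks[OF deg_le_agree[OF deg]]) (auto simp: disjoint_def)
  show ?thesis
    by (rule fully_sensitive_card_less[OF h \<open>d \<ge> 1\<close> fin]) (use sens in \<open>auto simp: h_def\<close>)
qed

text \<open>If \<open>Y\<close> agreed with \<open>X\<close> on the union of a largest disjoint
  family but had another value, the positions where they differ would contain a minimal block
  disjoint from the family, which could then be enlarged. The finite set \<open>V\<close> makes a
  largest family exist.\<close>

lemma ex_certificate_of_deg_le:
  assumes deg: "deg_le d (\<lambda>X. of_bool (f X))" and "d \<ge> 1" and "finite V"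
    and dep: "\<And>Y Z. Y \<inter> V = Z \<inter> V \<Longrightarrow> f Y = f Z"
  shows "\<exists>C\<subseteq>V. card C \<le> 2 * d^3 \<and> (\<forall>Y. Y \<inter> C = X \<inter> C \<longrightarrow> f Y = f X)"
proof -
  define \<F> where "\<F> = {\<B>. \<B> \<subseteq> Pow V \<and> disjoint \<B> \<and> (\<forall>B\<in>\<B>. minimal_block f X B)}"
  have "\<F> \<subseteq> Pow (Pow V)" by (auto simp: \<F>_def)
  then have finF: "finite \<F>" using \<open>finite V\<close> finite_subset by blast
  have "{} \<in> \<F>" by (auto simp: \<F>_def)
  then have "Max (card ` \<F>) \<in> card ` \<F>" using finF by (intro Max_in) auto
  then obtain \<B> where \<B>: "\<B> \<in> \<F>" and "card \<B> = Max (card ` \<F>)" by auto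
  then have max: "card \<B>' \<le> card \<B>" if "\<B>' \<in> \<F>" for \<B>' using that finF by auto
  have \<B>': "\<B> \<subseteq> Pow V" "disjoint \<B>" "\<And>B. B \<in> \<B> \<Longrightarrow> minimal_block f X B"
    using \<B> by (auto simp: \<F>_def)
  have finB: "finite \<B>" using \<B>'(1) \<open>finite V\<close> finite_subset by blast
  have "card \<B> < 2 * d^2"
    by (rule disjoint_blocks_card_less[OF deg \<open>d \<ge> 1\<close> finB \<B>'(2)])
      (use \<B>'(3) in \<open>auto simp: minimal_block_def\<close>)
  have "card (\<Union>\<B>) \<le> (\<Sum>B\<in>\<B>. card B)"
    by (rule card_Union_le_sum_card)
  also have "\<dots> \<le> (\<Sum>B\<in>\<B>. d)"
    using minimal_block_card_le[OF deg \<B>'(3)] by (intro sum_mono)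
  also have "\<dots> \<le> 2 * d^2 * d" using \<open>card \<B> < 2 * d^2\<close> by simp
  also have "\<dots> = 2 * d^3" by (simp add: power2_eq_square power3_eq_cube)
  finally have "card (\<Union>\<B>) \<le> 2 * d^3" .
  moreover have "f Y = f X" if Y: "Y \<inter> \<Union>\<B> = X \<inter> \<Union>\<B>" for Y
  proof (rule ccontr)
    assume ne: "f Y \<noteq> f X"
    \<comment> \<open>\<open>flip X Y\<close> is the symmetric difference; flipping \<open>X\<close>
      on \<open>D\<close> yields \<open>Y\<close> within \<open>V\<close>, which by
      \<open>dep\<close> is all that \<open>f\<close> sees.\<close>
    define D where "D = flip X Y \<inter> V"
    have "f (flip X D) = f Y" by (rule dep) (auto simp: D_def flip_def)
    then obtain B where B: "B \<subseteq> D" "minimal_block f X B"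
      using ex_minimal_block[of D f X] ne \<open>finite V\<close> by (auto simp: D_def)
    have "D \<inter> \<Union>\<B> = {}" using Y by (auto simp: D_def flip_def)
    then have BB: "\<And>B'. B' \<in> \<B> \<Longrightarrow> B \<inter> B' = {}" using B(1) by blast
    \<comment> \<open>A member of \<open>\<B>\<close> disjoint from all members would be disjoint
      from itself, hence empty.\<close>
    then have "B \<notin> \<B>" using minimal_block_nonempty[OF B(2)] by blast
    have "disjoint (insert B \<B>)" using \<B>'(2) BB by (auto simp: disjoint_def)
    moreover have "B \<subseteq> V" using B(1) by (auto simp: D_def)
    ultimately have "insert B \<B> \<in> \<F>" using \<B>' B(2) by (auto simp: \<F>_def)
    from max[OF this] show False using \<open>B \<notin> \<B>\<close> finB by simp
  qed
  moreover have "\<Union>\<B> \<subseteq> V" using \<B>'(1) by auto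
  ultimately show ?thesis by blast
qed

section \<open>AMPC algorithms have low degree\<close>

text \<open>A decision tree argument: split by the response \<open>T\<close> to the first query. Its
  indicator has degree \<open>d\<close>, and the rest of the run has budget at most
  \<open>b - 1\<close>, so each branch has degree at most \<open>d + (b - 1) * d\<close>. Finiteness
  of the range of \<open>D\<close> makes the sum over responses finite. The arbitrary
  \<open>\<phi>\<close> covers every statistic of the written list.\<close>

lemma deg_le_exec:
  fixes D :: "'a set \<Rightarrow> dds" and \<phi> :: "(akey \<times> nat) list \<Rightarrow> real"
  assumes ind: "\<And>k T. deg_le d (\<lambda>X. of_bool (D X k = T))" and fin: "finite (range D)"
  shows "deg_le (b * d) (\<lambda>X. \<phi> (exec n b P (D X) h))"
proof (induction n arbitrary: b h)
  case 0
  show ?case using deg_le_const by simp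
next
  case (Suc n)
  show ?case
  proof (cases "P h")
    case (Halt w)
    then show ?thesis using deg_le_const by simp
  next
    case (Query k)
    define c where "c T = (if T = {#} then 1 else size T)" for T :: "nat multiset"
    have c: "c T \<ge> 1" for T by (cases "T = {#}") (auto simp: c_def Suc_le_eq nonempty_has_size)
    define G where "G T X = (if b < c T then \<phi> []
        else \<phi> (exec n (b - c T) P (D X) (h @ [(k, T)])))" for T X
    have step: "\<phi> (exec (Suc n) b P (D X) h) = G (D X k) X" for X
      using Query by (simp add: G_def c_def Let_def)
    \<comment> \<open>With budget 0 any query ends the run and the result is constant. Otherwise
      \<open>d \<le> b * d\<close>, as the branch of an unaffordable response requires.\<close>
    show ?thesis
    proof (cases "b = 0")
      case True
      then have "G T X = \<phi> []" for T X using c[of T] by (simp add: G_def)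
      then show ?thesis unfolding step using deg_le_const by simp
    next
      case False
      define W where "W = range (\<lambda>X. D X k)"
      have "W = (\<lambda>E. E k) ` range D" by (auto simp: W_def)
      then have W: "finite W" using fin by simp
      have "deg_le (b * d) (\<lambda>X. of_bool (D X k = T) * G T X)" for T
      proof (cases "b < c T")
        case True
        have "deg_le (b * d) (\<lambda>X. of_bool (D X k = T))"
          by (rule deg_le_mono[OF ind]) (use False in auto)
        from deg_le_cmult[OF this, of "\<phi> []"] True show ?thesis by (simp add: G_def mult.commute)
      next
        case F: False
        have "Suc (b - c T) * d \<le> b * d"
          using c[of T] F by (intro mult_le_mono1) linarith
        then have "d + (b - c T) * d \<le> b * d" by simp
        moreover have "deg_le (d + (b - c T) * d)
            (\<lambda>X. of_bool (D X k = T) * \<phi> (exec n (b - c T) P (D X) (h @ [(k, T)])))"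
          by (intro deg_le_mult ind Suc.IH)
        ultimately have "deg_le (b * d)
            (\<lambda>X. of_bool (D X k = T) * \<phi> (exec n (b - c T) P (D X) (h @ [(k, T)])))"
          by (rule deg_le_mono[rotated])
        then show ?thesis using F by (simp add: G_def)
      qed
      then have "deg_le (b * d) (\<lambda>X. \<Sum>T\<in>W. of_bool (D X k = T) * G T X)"
        by (intro deg_le_sum)
      moreover have "(\<Sum>T\<in>W. of_bool (D X k = T) * G T X) = G (D X k) X" for X
      proof -
        have "(\<Sum>T\<in>W. of_bool (D X k = T) * G T X) = (\<Sum>T\<in>{D X k}. of_bool (D X k = T) * G T X)"
          using W by (intro sum.mono_neutral_right) (auto simp: W_def)
        then show ?thesis by simp
      qed
      ultimately show ?thesis unfolding step by simp
    qed
  qed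
qed

text \<open>Counts and sizes add up over the machines, so the degree does not depend on how many
  there are.\<close>

lemma deg_le_round_step:
  assumes ind: "\<And>k T. deg_le d (\<lambda>X. of_bool (D X k = T))" and fin: "finite (range D)"
  shows "deg_le (S * d) (\<lambda>X. real (count (round_step S Ms (D X) k) v))"
    and "deg_le (S * d) (\<lambda>X. real (size (round_step S Ms (D X) k)))"
proof -
  define W where "W w = mset (map snd (filter (\<lambda>p. fst p = k) w))" for w :: "(akey \<times> nat) list"
  have step: "round_step S Ms E k = (\<Sum>P\<leftarrow>Ms. W (machine_writes S P E))" for E
    by (simp add: round_step_def W_def)
  have "real (count (round_step S Ms E k) v)
      = (\<Sum>P\<leftarrow>Ms. real (count (W (machine_writes S P E)) v))" for E
    unfolding step by (induction Ms) auto
  moreover have "real (size (round_step S Ms E k))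
      = (\<Sum>P\<leftarrow>Ms. real (size (W (machine_writes S P E))))" for E
    unfolding step by (induction Ms) auto
  moreover have "deg_le (S * d) (\<lambda>X. \<Sum>P\<leftarrow>Ms. \<phi> (machine_writes S P (D X)))" for \<phi>
    unfolding machine_writes_def by (rule deg_le_sum_list) (rule deg_le_exec[OF ind fin])
  ultimately show "deg_le (S * d) (\<lambda>X. real (count (round_step S Ms (D X) k) v))"
    and "deg_le (S * d) (\<lambda>X. real (size (round_step S Ms (D X) k)))"
    by simp_all
qed

text \<open>The first product tests that T is contained in M X, the second that M X is no larger than T.\<close>

lemma deg_le_multiset_eq:
  fixes M :: "'a set \<Rightarrow> 'b multiset"
  assumes cnt: "\<And>v. deg_le e (\<lambda>X. real (count (M X) v))"
    and siz: "deg_le e (\<lambda>X. real (size (M X)))"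
    and le: "\<And>X. size (M X) \<le> S"
  shows "deg_le (S * e) (\<lambda>X. of_bool (M X = T))"
proof (cases "size T \<le> S")
  case False
  then have "M X \<noteq> T" for X using le[of X] by auto
  then show ?thesis using deg_le.zero by simp
next
  case True
  \<comment> \<open>One factor for each of the \<open>size T\<close> elements of \<open>T\<close>
    and one for each size from \<open>size T + 1\<close> to \<open>S\<close>: \<open>S\<close>
    factors in all. Each is scaled to be 1 at \<open>M X = T\<close>. A count that is too small is a
    root of \<open>p\<close>; a proper superset of \<open>T\<close> has its size in
    \<open>J\<close>, a root of \<open>q\<close>.\<close>
  define I where "I = (SIGMA v:set_mset T. {..<count T v})"
  define J where "J = {size T<..S}"
  define p where "p X = (\<Prod>(v, i)\<in>I. (real (count (M X) v) - real i) * (1 / (real (count T v) - real i)))" for X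
  define q where "q X = (\<Prod>j\<in>J. (real j - real (size (M X))) * (1 / (real j - real (size T))))" for X
  have finI: "finite I" and finJ: "finite J" by (auto simp: I_def J_def)
  have cI: "card I = size T"
    by (simp add: I_def size_multiset_overloaded_eq)
  have pd: "deg_le (\<Sum>z\<in>I. e) p"
    unfolding p_def
  proof (intro deg_le_prod finI)
    fix z assume "z \<in> I"
    obtain v i where z: "z = (v, i)" by force
    have "deg_le e (\<lambda>X. 1 / (real (count T v) - real i) * (real (count (M X) v) - real i))"
      by (intro deg_le_cmult deg_le_diff cnt deg_le_const)
    then show "deg_le e (\<lambda>X. case z of (v, i) \<Rightarrow>
        (real (count (M X) v) - real i) * (1 / (real (count T v) - real i)))"
      by (simp add: z mult.commute)
  qed
  have qd: "deg_le (\<Sum>j\<in>J. e) q"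
    unfolding q_def
  proof (intro deg_le_prod finJ)
    fix j
    have "deg_le e (\<lambda>X. 1 / (real j - real (size T)) * (real j - real (size (M X))))"
      by (intro deg_le_cmult deg_le_diff siz deg_le_const)
    then show "deg_le e (\<lambda>X. (real j - real (size (M X))) * (1 / (real j - real (size T))))"
      by (simp add: mult.commute)
  qed
  have "(\<Sum>z\<in>I. e) + (\<Sum>j\<in>J. e) = S * e"
    using True by (simp add: cI J_def flip: distrib_right)
  with deg_le_mult[OF pd qd] have "deg_le (S * e) (\<lambda>X. p X * q X)" by simp
  moreover have "p X * q X = of_bool (M X = T)" for X
  proof (cases "M X = T")
    case eq: True
    have "p X = 1" unfolding p_def by (rule prod.neutral) (auto simp: I_def eq)
    moreover have "q X = 1" unfolding q_def by (rule prod.neutral) (auto simp: J_def eq)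
    ultimately show ?thesis using eq by simp
  next
    case ne: False
    show ?thesis
    proof (cases "T \<subseteq># M X")
      case True
      then have "T \<subset># M X" using ne by auto
      then have "size (M X) \<in> J" using le[of X] by (auto simp: J_def mset_subset_size)
      then have "q X = 0" unfolding q_def using finJ by (intro prod_zero) force+
      then show ?thesis using ne by simp
    next
      case False
      then obtain v where "count (M X) v < count T v" by (auto simp: subseteq_mset_def not_le)
      then have "(v, count (M X) v) \<in> I"
        by (auto simp: I_def simp flip: count_greater_zero_iff)
      then have "p X = 0" unfolding p_def using finI
        by (intro prod_zero) (auto intro!: bexI[of _ "(v, count (M X) v)"])
      then show ?thesis using ne by simp
    qed
  qed
  ultimately show ?thesis by simp
qed

text \<open>Reads a set of indices as an input, so that the store contents become functions on sets.
  Ranging over all sets covers every input of length \<open>N\<close>, including invalid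
  ones.\<close>

definition bits :: "nat \<Rightarrow> nat set \<Rightarrow> bool list" where
  "bits N X = map (\<lambda>i. i \<in> X) [0..<N]"

lemma length_bits [simp]: "length (bits N X) = N"
  by (simp add: bits_def)

lemma bits_Collect_nth: "length x = N \<Longrightarrow> bits N {i. i < N \<and> x ! i} = x"
  by (rule nth_equalityI) (simp_all add: bits_def)

lemma bits_cong:
  assumes "X \<inter> {..<N} = Y \<inter> {..<N}" shows "bits N X = bits N Y"
proof -
  have "i \<in> X \<longleftrightarrow> i \<in> Y" if "i < N" for i using assms that by blast
  then show ?thesis by (simp add: bits_def)
qed

lemma finite_range_bits: "finite (range (bits N))"
proof -
  have "range (bits N) \<subseteq> {x. set x \<subseteq> UNIV \<and> length x = N}" by auto
  then show ?thesis by (rule finite_subset) (intro finite_lists_length_eq finite)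
qed

lemma deg_le_init_dds: "deg_le 1 (\<lambda>X. of_bool (init_dds (bits N X) k = T))"
proof (cases "\<exists>i<N. k = InKey i")
  case True
  then obtain i where i: "i < N" "k = InKey i" by blast
  have "init_dds (bits N X) k = {# of_bool (i \<in> X) #}" for X
    using i by (simp add: init_dds_def bits_def)
  \<comment> \<open>Affine interpolation between the two possible contents of the key, for bit 0 and
    bit 1.\<close>
  then have "of_bool (init_dds (bits N X) k = T)
      = (of_bool ({#1#} = T) - of_bool ({#0#} = T)) * of_bool (i \<in> X)
        + (of_bool ({#0#} = T) :: real)" for X
    by (cases "i \<in> X") auto
  then show ?thesis
    by (simp only:) (intro deg_le_add deg_le_cmult deg_le_mem deg_le_const order_refl)
next
  case False
  then have "init_dds (bits N X) k = {#}" for X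
    by (cases k) (auto simp: init_dds_def)
  then show ?thesis by (simp only: deg_le_const)
qed

lemma run_dds_Suc:
  "r < length A \<Longrightarrow> run_dds S A x (Suc r) = round_step S (A ! r) (run_dds S A x r)"
  by (simp add: run_dds_def take_Suc_conv_app_nth)

text \<open>A round costs one factor \<open>S\<close> for the queries of a machine and another for
  testing a whole multiset by counts and size. The second rests on the bound \<open>S\<close> per
  key on all inputs of length \<open>N\<close>, invalid ones included.\<close>

lemma deg_le_run_dds:
  assumes "valid_ampc S N A" "r \<le> length A"
  shows "deg_le (S ^ (2 * r)) (\<lambda>X. of_bool (run_dds S A (bits N X) r k = T))"
  using assms(2)
proof (induction r arbitrary: k T)
  case 0
  show ?case using deg_le_init_dds by (simp add: run_dds_def)
next
  case (Suc r)
  have fin: "finite (range (\<lambda>X. run_dds S A (bits N X) r))"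
    using finite_imageI[OF finite_range_bits, of "\<lambda>x. run_dds S A x r" N]
    by (simp add: image_image)
  have IH: "deg_le (S ^ (2 * r)) (\<lambda>X. of_bool (run_dds S A (bits N X) r k = T))" for k T
    using Suc by simp
  have "size (run_dds S A (bits N X) (Suc r) k) \<le> S" for X
    using assms(1) Suc.prems unfolding valid_ampc_def by auto
  then have "deg_le (S * (S * S ^ (2 * r)))
      (\<lambda>X. of_bool (round_step S (A ! r) (run_dds S A (bits N X) r) k = T))"
    using Suc.prems by (intro deg_le_multiset_eq deg_le_round_step IH fin) (simp add: run_dds_Suc)
  then show ?case using Suc.prems by (simp add: run_dds_Suc)
qed

text \<open>Inspecting only the answer key makes this a single content indicator, to which the
  degree bound applies directly, and gives a Boolean value even where the final store is not a
  proper output.\<close>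

definition ampc_fun :: "nat \<Rightarrow> det_alg \<Rightarrow> bool list \<Rightarrow> bool" where
  "ampc_fun S A x \<longleftrightarrow> run_dds S A x (length A) AnsKey = {#1#}"

lemma outputs_imp_ampc_fun: "outputs S A x b \<Longrightarrow> ampc_fun S A x = b"
  by (cases b) (auto simp: outputs_def ampc_fun_def)

lemma cert_complexity_ampc_fun:
  assumes "valid_ampc S N A" "S \<ge> 1" and \<Delta>: "\<Delta> \<subseteq> {x. length x = N}"
  shows "cert_complexity N \<Delta> (ampc_fun S A) \<le> 2 * S ^ (6 * length A)"
proof -
  define d where "d = S ^ (2 * length A)"
  have d3: "2 * d ^ 3 = 2 * S ^ (6 * length A)" by (simp add: d_def flip: power_mult)
  have "d \<ge> 1" using assms(2) by (simp add: d_def)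
  have deg: "deg_le d (\<lambda>X. of_bool (ampc_fun S A (bits N X)))"
    unfolding ampc_fun_def d_def by (rule deg_le_run_dds[OF assms(1)]) simp
  have "Inf (card ` {C. is_certificate N \<Delta> (ampc_fun S A) x C}) \<le> 2 * d ^ 3" if x: "x \<in> \<Delta>" for x
  proof -
    define X where "X = {i. i < N \<and> x ! i}"
    have X: "bits N X = x" unfolding X_def using x \<Delta> by (intro bits_Collect_nth) auto
    obtain C where C: "C \<subseteq> {..<N}" "card C \<le> 2 * d ^ 3"
      "\<And>Y. Y \<inter> C = X \<inter> C \<Longrightarrow> ampc_fun S A (bits N Y) = ampc_fun S A (bits N X)"
      using ex_certificate_of_deg_le[OF deg \<open>d \<ge> 1\<close> finite_lessThan[of N], of X] bits_cong by metis
    have "is_certificate N \<Delta> (ampc_fun S A) x C"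
      unfolding is_certificate_def
    proof (intro conjI C(1) ballI impI)
      fix y assume y: "y \<in> \<Delta>" "\<forall>i\<in>C. y ! i = x ! i"
      have "{i. i < N \<and> y ! i} \<inter> C = X \<inter> C" using y(2) by (auto simp: X_def)
      moreover have "bits N {i. i < N \<and> y ! i} = y" using y(1) \<Delta> by (intro bits_Collect_nth) auto
      ultimately show "ampc_fun S A y = ampc_fun S A x" using C(3) X by metis
    qed
    then have "Inf (card ` {C. is_certificate N \<Delta> (ampc_fun S A) x C}) \<le> card C"
      by (intro cInf_lower) auto
    then show ?thesis using C(2) by linarith
  qed
  then have "cert_complexity N \<Delta> (ampc_fun S A) \<le> 2 * d ^ 3" if "\<Delta> \<noteq> {}"
    unfolding cert_complexity_def using that by (intro cSup_least) blast+
  \<comment> \<open>The supremum of the empty set of naturals is 0; \<open>cSup_least\<close> covers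
    only nonempty sets.\<close>
  moreover have "cert_complexity N {} (ampc_fun S A) = 0"
    by (simp add: cert_complexity_def Sup_nat_def)
  ultimately show ?thesis unfolding d3 by (cases "\<Delta> = {}") simp_all
qed

section \<open>Averaging over the canonical distribution\<close>

text \<open>As one weighted sum the error is linear in the error indicators, which allows it to be
  exchanged with the expectation over algorithms. Each input weighs one half divided by the size of
  its class under \<open>g\<close>.\<close>

lemma canon_err_eq_sum:
  assumes "finite \<Delta>"
  shows "canon_err \<Delta> g f
    = (\<Sum>x\<in>\<Delta>. 1 / 2 / real (card {y \<in> \<Delta>. g y = g x}) * of_bool (f x \<noteq> g x))"
proof -
  have part: "(\<Sum>x\<in>{x\<in>\<Delta>. g x = b}. 1 / 2 / real (card {y \<in> \<Delta>. g y = g x}) * of_bool (f x \<noteq> g x))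
      = 1/2 * real (card {x\<in>\<Delta>. g x = b \<and> f x \<noteq> g x}) / real (card {x\<in>\<Delta>. g x = b})" for b
  proof -
    have "(\<Sum>x\<in>{x\<in>\<Delta>. g x = b}. 1 / 2 / real (card {y \<in> \<Delta>. g y = g x}) * of_bool (f x \<noteq> g x))
        = (\<Sum>x\<in>{x\<in>\<Delta>. g x = b}. 1 / 2 / real (card {y \<in> \<Delta>. g y = b}) * of_bool (f x \<noteq> g x))"
      by (intro sum.cong) auto
    also have "\<dots> = 1 / 2 / real (card {y \<in> \<Delta>. g y = b})
        * real (card ({x\<in>\<Delta>. g x = b} \<inter> {x. f x \<noteq> g x}))"
      using sum_of_bool_eq[of "{x\<in>\<Delta>. g x = b}" "\<lambda>x. f x \<noteq> g x", where 'a = real] assms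
      by (simp only: sum_distrib_left[symmetric] finite_Collect_conjI simp_thms Collect_mem_eq)
    also have "{x\<in>\<Delta>. g x = b} \<inter> {x. f x \<noteq> g x} = {x\<in>\<Delta>. g x = b \<and> f x \<noteq> g x}" by auto
    finally show ?thesis by simp
  qed
  have "\<Delta> = {x\<in>\<Delta>. g x = True} \<union> {x\<in>\<Delta>. g x = False}" by auto
  then have "(\<Sum>x\<in>\<Delta>. 1 / 2 / real (card {y \<in> \<Delta>. g y = g x}) * of_bool (f x \<noteq> g x))
      = (\<Sum>x\<in>{x\<in>\<Delta>. g x = True} \<union> {x\<in>\<Delta>. g x = False}.
          1 / 2 / real (card {y \<in> \<Delta>. g y = g x}) * of_bool (f x \<noteq> g x))"
    by presburger
  also have "\<dots> = canon_err \<Delta> g f"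
    using assms by (subst sum.union_disjoint) (auto simp only: part canon_err_def, auto)
  finally show ?thesis by simp
qed

text \<open>The total weight is the error of the negation of \<open>g\<close>, which is wrong
  everywhere. An empty class contributes 0 through division by zero, hence an inequality.\<close>

lemma canon_weights_le_1:
  fixes \<Delta> :: "bool list set" and g :: "bool list \<Rightarrow> bool"
  assumes "finite \<Delta>"
  shows "(\<Sum>x\<in>\<Delta>. 1 / 2 / real (card {y \<in> \<Delta>. g y = g x})) \<le> 1"
proof -
  have "(\<Sum>x\<in>\<Delta>. 1 / 2 / real (card {y \<in> \<Delta>. g y = g x})) = canon_err \<Delta> g (\<lambda>x. \<not> g x)"
    using canon_err_eq_sum[OF assms, of g "\<lambda>x. \<not> g x"] by simp
  also have "\<dots> \<le> 1" by (simp add: canon_err_def conj_ac)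
  finally show ?thesis .
qed

text \<open>The averaging direction of Yao's principle: if all algorithms in the support had error
  above \<open>\<delta>\<close>, so would the expectation, yet exchanging sum and expectation bounds
  it by \<open>\<delta>\<close>.\<close>

lemma ex_canon_err_le:
  fixes F :: "'a \<Rightarrow> bool list \<Rightarrow> bool" and \<mu> :: "'a pmf"
  assumes fin: "finite \<Delta>" and "0 \<le> \<delta>"
    and err: "\<And>x. x \<in> \<Delta> \<Longrightarrow> measure_pmf.prob \<mu> {A. F A x \<noteq> g x} \<le> \<delta>"
  shows "\<exists>A\<in>set_pmf \<mu>. canon_err \<Delta> g (F A) \<le> \<delta>"
proof (rule ccontr)
  assume "\<not> ?thesis"
  then have gt: "\<And>A. A \<in> set_pmf \<mu> \<Longrightarrow> \<delta> < canon_err \<Delta> g (F A)" by auto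
  define w where "w x = 1 / 2 / real (card {y \<in> \<Delta>. g y = g x})" for x
  define E where "E A = (\<Sum>x\<in>\<Delta>. w x * indicator {A. F A x \<noteq> g x} A)" for A
  have E: "canon_err \<Delta> g (F A) = E A" for A
    by (simp add: canon_err_eq_sum[OF fin] E_def w_def indicator_def of_bool_def)
  have ind: "integrable (measure_pmf \<mu>) (indicator B :: 'a \<Rightarrow> real)" for B
    by (intro measure_pmf.integrable_const_bound[where B = 1]) (auto simp: indicator_def)
  then have int: "integrable (measure_pmf \<mu>) E"
    unfolding E_def by (intro Bochner_Integration.integrable_sum integrable_mult_right)
  have "\<delta> = measure_pmf.expectation \<mu> (\<lambda>A. \<delta>)" by simp
  also have "\<dots> < measure_pmf.expectation \<mu> E"
    using gt by (intro measure_pmf.integral_less_AE_space int)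
      (auto simp: AE_measure_pmf_iff E measure_pmf.emeasure_space_1)
  also have "\<dots> = (\<Sum>x\<in>\<Delta>. w x * measure_pmf.prob \<mu> {A. F A x \<noteq> g x})"
    unfolding E_def by (subst Bochner_Integration.integral_sum)
      (auto simp only: integrable_mult_right ind integral_mult_right_zero, auto)
  also have "\<dots> \<le> (\<Sum>x\<in>\<Delta>. w x * \<delta>)"
    by (intro sum_mono mult_left_mono err) (auto simp: w_def)
  also have "\<dots> = (\<Sum>x\<in>\<Delta>. w x) * \<delta>" by (simp add: sum_distrib_right)
  also have "\<dots> \<le> 1 * \<delta>"
    using canon_weights_le_1[OF fin, of g] \<open>0 \<le> \<delta>\<close> by (intro mult_right_mono) (simp_all add: w_def)
  finally show False by simp
qed

theorem theorem5p7:
  fixes \<delta> :: real and N S R :: nat and \<Delta> :: "bool list set"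
    and g :: "bool list \<Rightarrow> bool" and \<mu> :: "det_alg pmf"
  assumes "0 \<le> \<delta>" and "\<delta> < 1"
    and "\<Delta> \<subseteq> {x. length x = N}"
    and "S \<ge> 2"
    and "\<forall>A\<in>set_pmf \<mu>. valid_ampc S N A \<and> length A \<le> R"
    and "\<exists>A\<in>set_pmf \<mu>. length A = R"
    and "\<forall>x\<in>\<Delta>. measure_pmf.prob \<mu> {A. outputs S A x (g x)} \<ge> 1 - \<delta>"
  shows "approx_cert N \<Delta> g \<delta> \<le> 2 * S ^ (6 * R)
         \<and> real R \<ge> 1/6 * log (real S) (real (approx_cert N \<Delta> g \<delta>) / 2)"
proof -
  have "finite {x :: bool list. length x = N}"
    using finite_lists_length_eq[of "UNIV :: bool set" N] by simp
  then have fin: "finite \<Delta>" using assms(3) finite_subset by blast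
  have "measure_pmf.prob \<mu> {A. ampc_fun S A x \<noteq> g x} \<le> \<delta>" if "x \<in> \<Delta>" for x
  proof -
    \<comment> \<open>Wherever \<open>A\<close> outputs \<open>g x\<close>, \<open>ampc_fun\<close>
      agrees with it, so a wrong value is a failure of the algorithm.\<close>
    have "measure_pmf.prob \<mu> {A. ampc_fun S A x \<noteq> g x}
        \<le> measure_pmf.prob \<mu> (UNIV - {A. outputs S A x (g x)})"
      by (intro measure_pmf.finite_measure_mono) (auto dest: outputs_imp_ampc_fun)
    also have "\<dots> = 1 - measure_pmf.prob \<mu> {A. outputs S A x (g x)}"
      using measure_pmf.prob_compl[of "{A. outputs S A x (g x)}" \<mu>] by simp
    also have "\<dots> \<le> \<delta>" using assms(7) that by fastforce
    finally show ?thesis .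
  qed
  then obtain A where A: "A \<in> set_pmf \<mu>" "canon_err \<Delta> g (ampc_fun S A) \<le> \<delta>"
    using ex_canon_err_le[OF fin assms(1), where F = "ampc_fun S"] by blast
  have "approx_cert N \<Delta> g \<delta> \<le> cert_complexity N \<Delta> (ampc_fun S A)"
    unfolding approx_cert_def using A(2) by (intro cInf_lower) auto
  also have "\<dots> \<le> 2 * S ^ (6 * length A)"
    using assms A(1) by (intro cert_complexity_ampc_fun) auto
  also have "\<dots> \<le> 2 * S ^ (6 * R)"
    using assms(4,5) A(1) by (intro mult_le_mono2 power_increasing) auto
  finally have bound: "approx_cert N \<Delta> g \<delta> \<le> 2 * S ^ (6 * R)" .
  moreover have "1/6 * log (real S) (real (approx_cert N \<Delta> g \<delta>) / 2) \<le> real R"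
  \<comment> \<open>The logarithm of 0 is 0 by convention, so the bound is trivial when the
    complexity is 0; monotonicity of the logarithm needs a positive argument.\<close>
  proof (cases "approx_cert N \<Delta> g \<delta> = 0")
    case True
    then show ?thesis by (simp add: log_def)
  next
    case False
    have "real (approx_cert N \<Delta> g \<delta>) \<le> real (2 * S ^ (6 * R))"
      using bound by (simp only: of_nat_le_iff)
    then have "log (real S) (real (approx_cert N \<Delta> g \<delta>) / 2) \<le> log (real S) (real S ^ (6 * R))"
      using False assms(4) by (intro log_mono) auto
    also have "\<dots> = real (6 * R)" using assms(4) by (subst log_nat_power) auto
    finally show ?thesis by simp
  qed
  ultimately show ?thesis by blast
qed

end
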